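(* Let $\mathcal{S}:=\{S^i\}_{i=1}^d$ be a finite collection of finite sets, and let $\mathcal{S}'$, $\alpha$ and $\mathcal{T}'$ be the output of the reformulation algorithm (described in the context) with inputs $\mathrm{CDC}(\mathcal{S})$ and $\mathrm{disjoint}\in\{\mathrm{False},\mathrm{True}\}$. Then $\mathcal{T}'$ is a junction tree of $\mathrm{CDC}(\mathcal{S}')$, and $$\mathrm{CDC}(\mathcal{S})=\mathrm{Proj}_{\lambda}\Big\{(\lambda,\lambda'):\ \lambda_v=\sum_{u:\alpha(u)=v}\lambda'_u\ \ \forall v\in\bigcup_{S\in\mathcal{S}}S,\quad\lambda'\in\mathrm{CDC}(\mathcal{S}')\Big\}.$$
   Context: For a finite collection $\mathcal{S}$ of finite sets let $J:=\bigcup_{S\in\mathcal{S}}S$, $Q(S):=\{\lambda\in\mathbb{R}^J:\sum_{v\in J}\lambda_v=1,\ \lambda_{J\setminus S}=0,\ \lambda\ge 0\}$, $\mathrm{CDC}(\mathcal{S}):=\bigcup_{S\in\mathcal{S}}Q(S)$. The intersection graph $\mathcal{K}_{\mathcal{S}}$ is the complete graph on vertex set $\mathcal{S}$; an edge $S^1S^2$ has middle set $\mathrm{mid}(S^1S^2)=S^1\cap S^2$ and weight $|S^1\cap S^2|$. A junction tree of $\mathrm{CDC}(\mathcal{S})$ is a tree with vertex set $\mathcal{S}$ such that for any $S^1,S^2\in\mathcal{S}$ the unique path $\mathcal{P}$ between them satisfies $S^1\cap S^2\subseteq S$ for every vertex $S$ of $\mathcal{P}$ and $S^1\cap S^2\subseteq\mathrm{mid}(e)$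 for every edge $e$ of $\mathcal{P}$. Reformulation algorithm. Input: $\mathrm{CDC}(\mathcal{S})$ with $\mathcal{S}=\{S^i\}_{i=1}^d$, and a Boolean $\mathrm{disjoint}$. (1) Create pairwise disjoint sets $S'^{,1},\dots,S'^{,d}$ of new indices with $|S'^{,i}|=|S^i|$, and define $\alpha$ on $\bigcup_iS'^{,i}$ so that it maps $S'^{,i}$ bijectively onto $S^i$ for each $i$. (2) If $\mathrm{disjoint}=\mathrm{True}$: return $\mathcal{S}'=\{S'^{,i}\}_{i=1}^d$, $\alpha$, and the path $\mathcal{T}'$ with vertex set $\mathcal{S}'$ and edges $S'^{,i}S'^{,i+1}$, $i=1,\dots,d-1$. (3) If $\mathrm{disjoint}=\mathrm{False}$: compute a maximum spanning tree $\mathcal{T}$ of $\mathcal{K}_{\mathcal{S}}$ and set $\mathcal{S}_{\mathrm{select}}:=\{S^1\}$. While $|\mathcal{S}_{\mathrm{select}}|<d$: find an edge $S^iS^j$ of $\mathcal{T}$ with $S^i\in\mathcal{S}_{\mathrm{select}}$ and $S^j\notin\mathcal{S}_{\mathrm{select}}$; add $S^j$ to $\mathcal{S}_{\mathrm{select}}$; for every $x\in S'^{,i}$ and $y\in S'^{,j}$ with $\alpha(x)=\alpha(y)$, replace $y$ by $x$ in $S'^{,j}$. At the end let $\mathcal{S}':=\{S'^{,i}\}_{i=1}^d$, restrict $\alpha$ to $\bigcup_{S'\in\mathcal{S}'}S'$, let $\mathcal{T}'$ be the tree obtained from $\mathcal{T}$ by replacing each vertex $S^i$ by $S'^{,i}$,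 and return $\mathcal{S}',\alpha,\mathcal{T}'$. $\mathrm{Proj}_\lambda$ denotes projection onto the $\lambda$-coordinates. *)

theory Defs
  imports Complex_Main "HOL-Library.FuncSet" "HOL-Library.Disjoint_Sets"
begin

text \<open>
  Edges are two-element sets of vertices.  The AFP entry Graph-Theory is not used: its graphs
  are directed, so that an undirected edge, represented by two opposite arcs, is itself a cycle
  and violates acyclicity there.
\<close>

record 'a ugraph =
  vertices :: "'a set"
  edges :: "'a set set"

definition complete_edges :: "'a set \<Rightarrow> 'a set set" where
  "complete_edges V = {{u, v} | u v. u \<in> V \<and> v \<in> V \<and> u \<noteq> v}"

definition simple_graph :: "'a ugraph \<Rightarrow> bool" where
  "simple_graph G \<longleftrightarrow> finite (vertices G) \<and> edges G \<subseteq> complete_edges (vertices G)"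

definition graph_path :: "'a ugraph \<Rightarrow> 'a \<Rightarrow> 'a list \<Rightarrow> 'a \<Rightarrow> bool" where
  "graph_path G u p v \<longleftrightarrow> p \<noteq> [] \<and> hd p = u \<and> last p = v \<and> distinct p \<and>
     set p \<subseteq> vertices G \<and> successively (\<lambda>a b. {a, b} \<in> edges G) p"

definition path_edges :: "'a list \<Rightarrow> 'a set set" where
  "path_edges p = {{p ! k, p ! Suc k} | k. Suc k < length p}"

definition graph_cycle :: "'a ugraph \<Rightarrow> 'a list \<Rightarrow> bool" where
  "graph_cycle G p \<longleftrightarrow> length p \<ge> 3 \<and> distinct p \<and> set p \<subseteq> vertices G \<and>
     successively (\<lambda>a b. {a, b} \<in> edges G) p \<and> {last p, hd p} \<in> edges G"

definition tree_graph :: "'a ugraph \<Rightarrow> bool" where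
  "tree_graph G \<longleftrightarrow> simple_graph G \<and> vertices G \<noteq> {} \<and>
     (\<forall>u\<in>vertices G. \<forall>v\<in>vertices G. \<exists>p. graph_path G u p v) \<and> (\<nexists>p. graph_cycle G p)"

definition spanning_tree :: "'a ugraph \<Rightarrow> 'a ugraph \<Rightarrow> bool" where
  "spanning_tree G T \<longleftrightarrow> tree_graph T \<and> vertices T = vertices G \<and> edges T \<subseteq> edges G"

definition maximum_spanning_tree :: "'a ugraph \<Rightarrow> ('a set \<Rightarrow> nat) \<Rightarrow> 'a ugraph \<Rightarrow> bool" where
  "maximum_spanning_tree G w T \<longleftrightarrow> spanning_tree G T \<and>
     (\<forall>T'. spanning_tree G T' \<longrightarrow> (\<Sum>e\<in>edges T'. w e) \<le> (\<Sum>e\<in>edges T. w e))"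

text \<open>
  \<open>\<real>\<^sup>J\<close> is the set \<open>J \<rightarrow>\<^sub>E UNIV\<close> of real functions on \<open>J\<close> (\<open>undefined\<close> outside \<open>J\<close>, so that
  equality is equality on \<open>J\<close>).
\<close>

definition Qset :: "'v set set \<Rightarrow> 'v set \<Rightarrow> ('v \<Rightarrow> real) set" where
  "Qset \<S> S = {x \<in> \<Union>\<S> \<rightarrow>\<^sub>E UNIV.
     (\<Sum>v\<in>\<Union>\<S>. x v) = 1 \<and> (\<forall>v\<in>\<Union>\<S> - S. x v = 0) \<and> (\<forall>v\<in>\<Union>\<S>. 0 \<le> x v)}"

definition CDC :: "'v set set \<Rightarrow> ('v \<Rightarrow> real) set" where
  "CDC \<S> = (\<Union>S\<in>\<S>. Qset \<S> S)"

text \<open>An edge is a set \<open>{S, T}\<close>, so this is \<open>S \<inter> T\<close>.\<close>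

definition mid :: "'v set set \<Rightarrow> 'v set" where
  "mid e = \<Inter>e"

definition intersection_graph :: "'v set set \<Rightarrow> 'v set ugraph" where
  "intersection_graph \<S> = \<lparr>vertices = \<S>, edges = complete_edges \<S>\<rparr>"

text \<open>The path quantified over below is unique because the graph is a tree.\<close>

definition junction_tree :: "'v set set \<Rightarrow> 'v set ugraph \<Rightarrow> bool" where
  "junction_tree \<S> T \<longleftrightarrow> tree_graph T \<and> vertices T = \<S> \<and>
     (\<forall>S1\<in>\<S>. \<forall>S2\<in>\<S>. \<forall>p. graph_path T S1 p S2 \<longrightarrow>
        (\<forall>S\<in>set p. S1 \<inter> S2 \<subseteq> S) \<and> (\<forall>e\<in>path_edges p. S1 \<inter> S2 \<subseteq> mid e))"

text \<open>
  The algorithm makes arbitrary choices (new indices, \<open>\<alpha>\<close>, the maximum spanning tree, the edge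
  picked in each iteration), so it is a relation between inputs and possible outputs.
  The input collection is \<open>{S 1, \<dots>, S d}\<close>.
\<close>

definition fresh_copies ::
    "(nat \<Rightarrow> 'v set) \<Rightarrow> nat \<Rightarrow> (nat \<Rightarrow> 'v set) \<Rightarrow> ('v \<Rightarrow> 'v) \<Rightarrow> bool" where
  "fresh_copies S d S' \<alpha> \<longleftrightarrow>
     disjoint_family_on S' {1..d} \<and>
     (\<Union>i\<in>{1..d}. S' i) \<inter> (\<Union>i\<in>{1..d}. S i) = {} \<and>
     (\<forall>i\<in>{1..d}. finite (S' i) \<and> card (S' i) = card (S i)) \<and>
     \<alpha> \<in> extensional (\<Union>i\<in>{1..d}. S' i) \<and>
     (\<forall>i\<in>{1..d}. bij_betw \<alpha> (S' i) (S i))"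

text \<open>
  The set \<open>B\<close> after replacing \<open>y\<close> by \<open>x\<close> for all \<open>x \<in> A\<close>, \<open>y \<in> B\<close> with \<open>\<alpha> x = \<alpha> y\<close>.
\<close>

definition replace_indices :: "('v \<Rightarrow> 'v) \<Rightarrow> 'v set \<Rightarrow> 'v set \<Rightarrow> 'v set" where
  "replace_indices \<alpha> A B =
     (B - {y \<in> B. \<exists>x\<in>A. \<alpha> x = \<alpha> y}) \<union> {x \<in> A. \<exists>y\<in>B. \<alpha> x = \<alpha> y}"

text \<open>
  States (selected sets, current sets \<open>S' 1, \<dots>, S' d\<close>) that the while loop can reach from the
  initial sets \<open>S0\<close>.
\<close>

inductive merge_loop ::
    "(nat \<Rightarrow> 'v set) \<Rightarrow> nat \<Rightarrow> 'v set ugraph \<Rightarrow> ('v \<Rightarrow> 'v) \<Rightarrow> (nat \<Rightarrow> 'v set) \<Rightarrow>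
     'v set set \<Rightarrow> (nat \<Rightarrow> 'v set) \<Rightarrow> bool"
  for S d T \<alpha> S0 where
  start: "merge_loop S d T \<alpha> S0 {S 1} S0"
| step: "\<lbrakk>merge_loop S d T \<alpha> S0 sel S'; card sel < d;
          i \<in> {1..d}; j \<in> {1..d}; {S i, S j} \<in> edges T; S i \<in> sel; S j \<notin> sel\<rbrakk>
    \<Longrightarrow> merge_loop S d T \<alpha> S0 (insert (S j) sel) (S'(j := replace_indices \<alpha> (S' i) (S' j)))"

inductive reformulation ::
    "(nat \<Rightarrow> 'v set) \<Rightarrow> nat \<Rightarrow> bool \<Rightarrow> 'v set set \<Rightarrow> ('v \<Rightarrow> 'v) \<Rightarrow> 'v set ugraph \<Rightarrow> bool"
  for S d where
  disjoint_True:
    "fresh_copies S d S' \<alpha> \<Longrightarrow>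
     reformulation S d True (S' ` {1..d}) \<alpha>
       \<lparr>vertices = S' ` {1..d}, edges = {{S' i, S' (i + 1)} | i. 1 \<le> i \<and> i < d}\<rparr>"
| disjoint_False:
    "\<lbrakk>fresh_copies S d S0 \<alpha>;
      maximum_spanning_tree (intersection_graph (S ` {1..d})) (\<lambda>e. card (mid e)) T;
      merge_loop S d T \<alpha> S0 sel S'; \<not> card sel < d\<rbrakk> \<Longrightarrow>
     reformulation S d False (S' ` {1..d}) (restrict \<alpha> (\<Union>i\<in>{1..d}. S' i))
       \<lparr>vertices = S' ` {1..d},
        edges = {{S' i, S' j} | i j. i \<in> {1..d} \<and> j \<in> {1..d} \<and> {S i, S j} \<in> edges T}\<rparr>"

end

theory Submission
  imports Defs
begin

text \<open>
  When the merge loop attaches \<open>S j\<close> to \<open>S i\<close>, the updated \<open>S' j\<close> consists of indices of \<open>S' i\<close>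
  and of indices that occur in no selected set.  So an index that \<open>S' j\<close> shares with a selected
  set also lies in \<open>S' i\<close>, and extending a path to \<open>S i\<close> by \<open>S j\<close> keeps the running intersection
  property.  Only one good path per pair of vertices is needed, since paths in a tree are unique.
  The projection formula only uses that \<open>\<alpha>\<close> remains a bijection from every \<open>S' i\<close> onto \<open>S i\<close>.
\<close>

section \<open>Paths and cycles\<close>

lemma successively_edges_rev:
  "successively (\<lambda>a b. {a, b} \<in> E) (rev p) \<longleftrightarrow> successively (\<lambda>a b. {a, b} \<in> E) p"
  by (simp add: insert_commute)

lemma graph_path_rev: "graph_path G u p v \<Longrightarrow> graph_path G v (rev p) u"
  by (auto simp: graph_path_def hd_rev last_rev insert_commute)

lemma graph_path_snoc:
  assumes "graph_path G u p v" "w \<in> vertices G" "w \<notin> set p" "{v, w} \<in> edges G"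
  shows "graph_path G u (p @ [w]) w"
  using assms by (auto simp: graph_path_def successively_append_iff)

lemma graph_path_same: "graph_path G u p u \<Longrightarrow> p = [u]"
  by (cases p) (auto simp: graph_path_def split: if_splits)

text \<open>Predecessor and successor around the cycle serve as the two neighbours. They differ
  because a cycle has at least three distinct vertices. This excludes cycles in the path graph
  below, where a largest vertex has too few neighbours.\<close>

lemma graph_cycle_two_neighbours:
  assumes "graph_cycle G p" "x \<in> set p"
  obtains y z where "y \<noteq> z" "y \<in> set p" "z \<in> set p" "{x, y} \<in> edges G" "{x, z} \<in> edges G"
proof -
  have p: "length p \<ge> 3" "distinct p" "successively (\<lambda>a b. {a, b} \<in> edges G) p"
    "{last p, hd p} \<in> edges G"
    using assms(1) by (auto simp: graph_cycle_def)
  obtain as bs where ab: "p = as @ x # bs"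
    using split_list[OF assms(2)] by blast
  \<comment> \<open>At either end of the list the neighbour is found across the closing edge
    \<open>{last p, hd p}\<close>.\<close>
  let ?y = "if as = [] then last p else last as"
  let ?z = "if bs = [] then hd p else hd bs"
  have "?y \<noteq> ?z"
  proof (cases as rule: rev_cases)
    case Nil
    then show ?thesis
      using p(1,2) by (cases bs) (auto simp: ab Suc_le_eq)
  next
    case (snoc as' y)
    then show ?thesis
      using p(1,2) by (cases as'; cases bs) (auto simp: ab)
  qed
  moreover have "?y \<in> set p" "?z \<in> set p"
    unfolding ab by (cases as; simp)+
  moreover have "{x, ?y} \<in> edges G"
    using p(3,4) by (auto simp: ab successively_append_iff insert_commute)
  moreover have "{x, ?z} \<in> edges G"
    using p(3,4) by (auto simp: ab successively_append_iff successively_Cons insert_commute)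
  ultimately show thesis
    by (rule that)
qed

text \<open>Two paths that leave \<open>u\<close> by different edges close up to a cycle where they first meet again.\<close>

lemma diverging_paths_cycle:
  assumes p: "graph_path G u (u # p) v" and q: "graph_path G u (u # q) v"
    and ne: "p \<noteq> []" "q \<noteq> []" "hd p \<noteq> hd q"
  shows "\<exists>c. graph_cycle G c"
proof -
  \<comment> \<open>Both paths end in \<open>v\<close>, so they meet again after
    \<open>u\<close>.\<close>
  have "last p \<in> set p \<inter> set q"
    using p q ne by (metis IntI graph_path_def last_ConsR last_in_set)
  then have "\<exists>x\<in>set p. x \<in> set q"
    by blast
  \<comment> \<open>Choosing the first vertex of \<open>p\<close> on \<open>q\<close> makes
    \<open>p1\<close> avoid \<open>q\<close>, so the closed walk built from \<open>p1\<close> and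
    \<open>q1\<close> repeats no vertex.\<close>
  then obtain p1 w p2 where pw: "p = p1 @ w # p2" "w \<in> set q" "\<forall>x\<in>set p1. x \<notin> set q"
    by (rule split_list_first_propE)
  then obtain q1 q2 where qw: "q = q1 @ w # q2"
    by (meson split_list)
  let ?c = "u # p1 @ w # rev q1"
  \<comment> \<open>If both were empty, \<open>p\<close> and \<open>q\<close> would both start with
    \<open>w\<close>. This is where the difference of the first steps enters, and it gives length at
    least 3.\<close>
  have "p1 \<noteq> [] \<or> q1 \<noteq> []"
    using ne pw qw by auto
  then have "length ?c \<ge> 3"
    by (cases p1; cases q1) auto
  moreover have "distinct ?c" "set ?c \<subseteq> vertices G"
    using p q pw by (auto simp: graph_path_def qw)
  moreover have "successively (\<lambda>a b. {a, b} \<in> edges G) (u # p1 @ [w])"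
    using p by (auto simp: graph_path_def pw successively_append_iff successively_Cons hd_append)
  moreover have "successively (\<lambda>a b. {a, b} \<in> edges G) (rev (u # q1 @ [w]))"
    unfolding successively_edges_rev
    using q by (auto simp: graph_path_def qw successively_append_iff successively_Cons hd_append)
  ultimately have "graph_cycle G ?c"
    by (auto simp: graph_cycle_def successively_append_iff successively_Cons hd_append
        last_rev insert_commute split: if_splits)
  then show ?thesis ..
qed

text \<open>Induction strips the common first vertex: if the second vertices differed, the two paths
  would close up to a cycle. If one path stops at once, then \<open>u = v\<close> and both are
  trivial.\<close>

lemma graph_path_unique:
  assumes "\<nexists>c. graph_cycle G c" "graph_path G u p v" "graph_path G u q v"
  shows "p = q"
  using assms(2,3)
proof (induction p arbitrary: u q)
  case Nil
  then show ?case by (simp add: graph_path_def)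
next
  case (Cons a p)
  have a: "a = u" using Cons.prems by (simp add: graph_path_def)
  obtain q' where q: "q = u # q'"
    using Cons.prems by (cases q) (auto simp: graph_path_def)
  show ?case
  proof (cases "p = [] \<or> q' = []")
    case True
    then have "u = v"
      using Cons.prems q a by (auto simp: graph_path_def)
    then show ?thesis
      using Cons.prems graph_path_same by metis
  next
    case False
    have "hd p = hd q'"
      using diverging_paths_cycle[of G u p v q'] Cons.prems False assms(1) q a by blast
    moreover have "graph_path G (hd p) p v" "graph_path G (hd q') q' v"
      using Cons.prems False by (auto simp: graph_path_def q successively_Cons)
    ultimately show ?thesis
      using Cons.IH a q by metis
  qed
qed

text \<open>Uniqueness of paths in a tree lets one good path stand for all. The condition on middle
  sets follows from the one on vertices, since \<open>mid e\<close> is the intersection of the two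
  endpoints of \<open>e\<close>.\<close>

lemma junction_treeI:
  assumes tree: "tree_graph T" and V: "vertices T = \<S>"
    and ex: "\<And>A B. A \<in> \<S> \<Longrightarrow> B \<in> \<S> \<Longrightarrow> \<exists>p. graph_path T A p B \<and> (\<forall>C\<in>set p. A \<inter> B \<subseteq> C)"
  shows "junction_tree \<S> T"
  unfolding junction_tree_def
proof (intro conjI ballI allI impI tree V)
  fix A B p assume AB: "A \<in> \<S>" "B \<in> \<S>" and p: "graph_path T A p B"
  have *: "A \<inter> B \<subseteq> C" if "C \<in> set p" for C
    using ex[OF AB] p that graph_path_unique tree unfolding tree_graph_def by metis
  show "A \<inter> B \<subseteq> C" if "C \<in> set p" for C
    using * that .
  show "A \<inter> B \<subseteq> mid e" if e: "e \<in> path_edges p" for e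
  proof -
    obtain k where "e = {p ! k, p ! Suc k}" "Suc k < length p"
      using e by (auto simp: path_edges_def)
    then show ?thesis
      using *[of "p ! k"] *[of "p ! Suc k"] by (auto simp: mid_def)
  qed
qed

section \<open>Images of graphs\<close>

text \<open>Relabelling of vertices. Both output trees of the algorithm have this form: one relabels
  a path on the indices, the other relabels the spanning tree.\<close>

definition map_ugraph :: "('a \<Rightarrow> 'b) \<Rightarrow> 'a ugraph \<Rightarrow> 'b ugraph" where
  "map_ugraph f G = \<lparr>vertices = f ` vertices G, edges = (`) f ` edges G\<rparr>"

lemma graph_path_map:
  assumes "inj_on f (vertices G)" "graph_path G u p v"
  shows "graph_path (map_ugraph f G) (f u) (map f p) (f v)"
proof -
  have "successively (\<lambda>a b. {f a, f b} \<in> edges (map_ugraph f G)) p"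
    using assms(2) unfolding graph_path_def
    by (elim conjE successively_mono) (auto simp: map_ugraph_def intro!: image_eqI[of _ _ "{_, _}"])
  then show ?thesis
    using assms unfolding graph_path_def
    by (auto simp: hd_map last_map distinct_map successively_map map_ugraph_def
        intro: inj_on_subset)
qed

text \<open>Simplicity places every edge inside the vertex set, where the inverse of
  \<open>f\<close> undoes \<open>f\<close>.\<close>

lemma map_ugraph_edge_inv:
  assumes "simple_graph G" "inj_on f (vertices G)" "a \<in> vertices (map_ugraph f G)"
    "b \<in> vertices (map_ugraph f G)" "{a, b} \<in> edges (map_ugraph f G)"
  shows "{inv_into (vertices G) f a, inv_into (vertices G) f b} \<in> edges G"
proof -
  obtain e where e: "e \<in> edges G" "{a, b} = f ` e"
    using assms(5) by (auto simp: map_ugraph_def)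
  have "inv_into (vertices G) f ` {a, b} = e"
    unfolding e(2)
    using e(1) assms(1,2)
    by (intro inv_into_image_cancel) (auto simp: simple_graph_def complete_edges_def)
  then show ?thesis using e(1) by simp
qed

text \<open>Connecting paths are pushed forward along \<open>f\<close>; a cycle in the image would
  be pulled back along its inverse to a cycle in \<open>G\<close>.\<close>

lemma tree_graph_map:
  assumes tree: "tree_graph G" and inj: "inj_on f (vertices G)"
  shows "tree_graph (map_ugraph f G)"
proof -
  let ?g = "inv_into (vertices G) f"
  have simple: "simple_graph G" using tree by (simp add: tree_graph_def)
  have "simple_graph (map_ugraph f G)"
    using simple inj unfolding simple_graph_def map_ugraph_def complete_edges_def
    by (fastforce dest: inj_onD)
  moreover have "vertices (map_ugraph f G) \<noteq> {}"
    using tree by (auto simp: tree_graph_def map_ugraph_def)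
  moreover have "\<exists>p. graph_path (map_ugraph f G) u p v"
    if "u \<in> vertices (map_ugraph f G)" "v \<in> vertices (map_ugraph f G)" for u v
    using that tree graph_path_map[OF inj] by (fastforce simp: tree_graph_def map_ugraph_def)
  moreover have "\<not> graph_cycle (map_ugraph f G) p" for p
  proof
    assume p: "graph_cycle (map_ugraph f G) p"
    have V: "vertices (map_ugraph f G) = f ` vertices G"
      by (simp add: map_ugraph_def)
    have set: "set p \<subseteq> f ` vertices G" "p \<noteq> []"
      using p V by (auto simp: graph_cycle_def)
    note inv = map_ugraph_edge_inv[OF simple inj]
    have "successively (\<lambda>a b. {?g a, ?g b} \<in> edges G) p"
      using p unfolding graph_cycle_def
      by (elim conjE successively_mono) (auto intro!: inv)
    moreover have "{?g (last p), ?g (hd p)} \<in> edges G"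
      using p set by (intro inv) (auto simp: graph_cycle_def)
    moreover have "distinct (map ?g p)"
      using p set by (auto simp: graph_cycle_def distinct_map intro: inj_on_subset[OF inj_on_inv_into])
    ultimately have "graph_cycle G (map ?g p)"
      using p set by (auto simp: graph_cycle_def successively_map last_map hd_map inv_into_into subset_iff)
    then show False
      using tree by (simp add: tree_graph_def)
  qed
  ultimately show ?thesis
    by (simp add: tree_graph_def)
qed

section \<open>The path graph on the indices\<close>

definition line_graph :: "nat \<Rightarrow> nat ugraph" where
  "line_graph d = \<lparr>vertices = {1..d}, edges = {{i, i + 1} | i. 1 \<le> i \<and> i < d}\<rparr>"

text \<open>Intervals of consecutive integers, reversed if necessary, connect any two vertices. The
  largest vertex of a cycle would need two distinct neighbours on the cycle, but only its
  predecessor is not larger.\<close>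

lemma tree_graph_line:
  assumes "d \<ge> 1"
  shows "tree_graph (line_graph d)"
proof -
  have edge: "{a, b} \<in> edges (line_graph d) \<longleftrightarrow>
      a \<in> {1..d} \<and> b \<in> {1..d} \<and> (b = Suc a \<or> a = Suc b)" for a b
    by (auto simp: line_graph_def doubleton_eq_iff)
  have "simple_graph (line_graph d)"
    by (force simp: simple_graph_def line_graph_def complete_edges_def)
  moreover have "\<exists>p. graph_path (line_graph d) u p v"
    if uv: "u \<in> {1..d}" "v \<in> {1..d}" for u v
  proof -
    have up: "graph_path (line_graph d) a [a..<Suc b] b" if "1 \<le> a" "a \<le> b" "b \<le> d" for a b
      using that unfolding graph_path_def successively_conv_nth edge
      by (auto simp: line_graph_def hd_upt simp del: upt_Suc)
    show ?thesis
    proof (cases "u \<le> v")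
      case True
      then show ?thesis using up uv by auto
    next
      case False
      then show ?thesis using graph_path_rev[OF up[of v u]] uv by auto
    qed
  qed
  moreover have "\<not> graph_cycle (line_graph d) p" for p
  proof
    assume p: "graph_cycle (line_graph d) p"
    then have "Max (set p) \<in> set p"
      by (intro Max_in) (auto simp: graph_cycle_def)
    with p obtain y z where "y \<noteq> z" "y \<in> set p" "z \<in> set p"
      "{Max (set p), y} \<in> edges (line_graph d)" "{Max (set p), z} \<in> edges (line_graph d)"
      by (rule graph_cycle_two_neighbours)
    moreover have "y \<le> Max (set p)" "z \<le> Max (set p)"
      using calculation by auto
    ultimately show False
      unfolding edge by linarith
  qed
  ultimately show ?thesis
    using assms by (auto simp: tree_graph_def line_graph_def)
qed

section \<open>The merge loop\<close>

text \<open>An index is only exchanged for one with the same value under \<alpha>, so the image is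
  preserved. Injectivity on \<open>A\<close> ensures that no value acquires two indices.\<close>

lemma bij_betw_replace_indices:
  assumes A: "inj_on \<alpha> A" and B: "bij_betw \<alpha> B B'"
  shows "bij_betw \<alpha> (replace_indices \<alpha> A B) B'"
proof -
  have "inj_on \<alpha> (replace_indices \<alpha> A B)"
  proof (rule inj_onI)
    \<comment> \<open>An element kept from \<open>B\<close> has a value not attained on
      \<open>A\<close>, so two elements with equal values lie on the same side, where \<alpha> is
      injective.\<close>
    have *: "x \<in> A \<or> x \<in> B \<and> (\<forall>a\<in>A. \<alpha> a \<noteq> \<alpha> x)" if "x \<in> replace_indices \<alpha> A B" for x
      using that by (auto simp: replace_indices_def)
    fix x y assume xy: "x \<in> replace_indices \<alpha> A B" "y \<in> replace_indices \<alpha> A B" "\<alpha> x = \<alpha> y"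
    then consider "x \<in> A" "y \<in> A" | "x \<in> B" "y \<in> B"
      using *[of x] *[of y] by metis
    then show "x = y"
      using A B xy(3) by cases (auto simp: bij_betw_def dest: inj_onD)
  qed
  moreover have "\<alpha> ` replace_indices \<alpha> A B = \<alpha> ` B"
  proof
    show "\<alpha> ` B \<subseteq> \<alpha> ` replace_indices \<alpha> A B"
    proof
      fix v assume "v \<in> \<alpha> ` B"
      then obtain y where y: "y \<in> B" "v = \<alpha> y" by blast
      show "v \<in> \<alpha> ` replace_indices \<alpha> A B"
      proof (cases "\<exists>x\<in>A. \<alpha> x = \<alpha> y")
        case True
        then obtain x where "x \<in> A" "\<alpha> x = \<alpha> y" by blast
        then show ?thesis
          using y by (intro image_eqI[of _ _ x]) (auto simp: replace_indices_def)
      next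
        case False
        then show ?thesis
          using y by (intro image_eqI[of _ _ y]) (auto simp: replace_indices_def)
      qed
    qed
  qed (auto simp: replace_indices_def)
  ultimately show ?thesis
    using B by (simp add: bij_betw_def)
qed

text \<open>The third clause says that \<open>S' j\<close> is still a fresh copy when it is
  attached, and the fourth keeps that copy apart from all selected sets. Keeping paths inside
  \<open>sel\<close> makes the appended vertex new and protects old paths from the update at
  \<open>j\<close>.\<close>

lemma merge_loop_invariant:
  assumes loop: "merge_loop S d T \<alpha> S0 sel S'"
    and d: "d \<ge> 1" and inj: "inj_on S {1..d}" and fresh: "fresh_copies S d S0 \<alpha>"
    and V: "vertices T = S ` {1..d}"
  shows "sel \<subseteq> S ` {1..d} \<and>
    (\<forall>i\<in>{1..d}. bij_betw \<alpha> (S' i) (S i)) \<and>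
    (\<forall>i\<in>{1..d}. S i \<notin> sel \<longrightarrow> S' i = S0 i) \<and>
    (\<forall>i\<in>{1..d}. \<forall>j\<in>{1..d}. S i \<in> sel \<longrightarrow> S j \<notin> sel \<longrightarrow> S' i \<inter> S0 j = {}) \<and>
    (\<forall>a\<in>{1..d}. \<forall>b\<in>{1..d}. S a \<in> sel \<longrightarrow> S b \<in> sel \<longrightarrow>
      (\<exists>p. graph_path T (S a) p (S b) \<and> set p \<subseteq> sel \<and>
        (\<forall>k\<in>{1..d}. S k \<in> set p \<longrightarrow> S' a \<inter> S' b \<subseteq> S' k)))"
  using loop
proof induction
  case start
  \<comment> \<open>\<open>sel\<close> records sets while \<open>S'\<close> is indexed by numbers;
    injectivity of \<open>S\<close> translates between the two.\<close>
  have 1: "S i = S 1 \<Longrightarrow> i = 1" if "i \<in> {1..d}" for i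
    using inj d that by (auto dest: inj_onD)
  have disj: "S0 i \<inter> S0 j = {}" if "i \<in> {1..d}" "j \<in> {1..d}" "i \<noteq> j" for i j
    using fresh that by (auto simp: fresh_copies_def disjoint_family_on_def)
  have path: "graph_path T (S 1) [S 1] (S 1)"
    using d by (auto simp: graph_path_def V)
  have "\<exists>p. graph_path T (S a) p (S b) \<and> set p \<subseteq> {S 1} \<and>
      (\<forall>k\<in>{1..d}. S k \<in> set p \<longrightarrow> S0 a \<inter> S0 b \<subseteq> S0 k)"
    if "a \<in> {1..d}" "b \<in> {1..d}" "S a \<in> {S 1}" "S b \<in> {S 1}" for a b
  proof -
    have "a = 1" "b = 1"
      using that 1 by blast+
    moreover have "S0 1 \<inter> S0 1 \<subseteq> S0 k" if "k \<in> {1..d}" "S k \<in> set [S 1]" for k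
    proof -
      have "k = 1" using that 1 by simp
      then show ?thesis by simp
    qed
    ultimately show ?thesis
      using path by (intro exI[of _ "[S 1]"] conjI ballI impI) (simp_all del: One_nat_def)
  qed
  moreover have "\<forall>i\<in>{1..d}. bij_betw \<alpha> (S0 i) (S i)"
    using fresh by (simp add: fresh_copies_def)
  moreover have "S0 i \<inter> S0 j = {}"
    if "i \<in> {1..d}" "j \<in> {1..d}" "S i \<in> {S 1}" "S j \<notin> {S 1}" for i j
    using disj that by auto
  ultimately show ?case
    using d by simp
next
  case (step sel S' i j)
  have ij: "i \<in> {1..d}" "j \<in> {1..d}" "{S i, S j} \<in> edges T" "S i \<in> sel" "S j \<notin> sel"
    by fact+
  from step.IH have sel: "sel \<subseteq> S ` {1..d}"
    and bij: "\<And>k. k \<in> {1..d} \<Longrightarrow> bij_betw \<alpha> (S' k) (S k)"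
    and unsel: "\<And>k. k \<in> {1..d} \<Longrightarrow> S k \<notin> sel \<Longrightarrow> S' k = S0 k"
    and sep: "\<And>a b. a \<in> {1..d} \<Longrightarrow> b \<in> {1..d} \<Longrightarrow> S a \<in> sel \<Longrightarrow> S b \<notin> sel \<Longrightarrow> S' a \<inter> S0 b = {}"
    and path: "\<And>a b. a \<in> {1..d} \<Longrightarrow> b \<in> {1..d} \<Longrightarrow> S a \<in> sel \<Longrightarrow> S b \<in> sel \<Longrightarrow>
      \<exists>p. graph_path T (S a) p (S b) \<and> set p \<subseteq> sel \<and>
        (\<forall>k\<in>{1..d}. S k \<in> set p \<longrightarrow> S' a \<inter> S' b \<subseteq> S' k)"
    by simp_all
  have neq: "k \<noteq> j" if "S k \<in> sel" for k
    using that ij(5) by blast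
  have Sj: "k = j" if "k \<in> {1..d}" "S k = S j" for k
    using inj_onD[OF inj that(2,1) ij(2)] .
  have disj: "S0 a \<inter> S0 b = {}" if "a \<in> {1..d}" "b \<in> {1..d}" "a \<noteq> b" for a b
    using fresh that by (auto simp: fresh_copies_def disjoint_family_on_def)
  define R where "R = replace_indices \<alpha> (S' i) (S' j)"
  let ?S' = "S'(j := R)"
  have R: "R \<subseteq> S' i \<union> S0 j"
    unfolding R_def unsel[OF ij(2,5)] by (auto simp: replace_indices_def)
  have bij_R: "bij_betw \<alpha> R (S j)"
    unfolding R_def using bij[OF ij(1)] bij[OF ij(2)]
    by (intro bij_betw_replace_indices) (simp_all add: bij_betw_def)
  have new: "\<exists>p. graph_path T (S a) p (S j) \<and> set p \<subseteq> insert (S j) sel \<and>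
      (\<forall>k\<in>{1..d}. S k \<in> set p \<longrightarrow> ?S' a \<inter> ?S' j \<subseteq> ?S' k)"
    if a: "a \<in> {1..d}" "S a \<in> sel" for a
  proof -
    obtain p where p: "graph_path T (S a) p (S i)" "set p \<subseteq> sel"
      "\<And>k. k \<in> {1..d} \<Longrightarrow> S k \<in> set p \<Longrightarrow> S' a \<inter> S' i \<subseteq> S' k"
      using path[OF a(1) ij(1) a(2) ij(4)] by blast
    have "S j \<notin> set p"
      using p(2) ij(5) by blast
    then have "graph_path T (S a) (p @ [S j]) (S j)"
      using p(1) ij(2,3) by (intro graph_path_snoc) (simp_all add: V)
    \<comment> \<open>The part of \<open>R\<close> outside \<open>S' i\<close> comes from
      \<open>S0 j\<close>, which is disjoint from the selected \<open>S' a\<close>. Hence everything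
      shared with the new set is already shared with \<open>S' i\<close>, and the path to
      \<open>S i\<close> carries it.\<close>
    moreover have "S' a \<inter> R \<subseteq> S' a \<inter> S' i"
      using R sep[OF a(1) ij(2) a(2) ij(5)] by blast
    then have "?S' a \<inter> ?S' j \<subseteq> ?S' k" if "k \<in> {1..d}" "S k \<in> set (p @ [S j])" for k
      using p(3)[of k] neq[OF a(2)] Sj[of k] that by (cases "k = j") auto
    moreover have "set (p @ [S j]) \<subseteq> insert (S j) sel"
      using p(2) by auto
    ultimately show ?thesis
      by blast
  qed
  have path': "\<exists>p. graph_path T (S a) p (S b) \<and> set p \<subseteq> insert (S j) sel \<and>
      (\<forall>k\<in>{1..d}. S k \<in> set p \<longrightarrow> ?S' a \<inter> ?S' b \<subseteq> ?S' k)"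
    if ab: "a \<in> {1..d}" "b \<in> {1..d}" "S a \<in> insert (S j) sel" "S b \<in> insert (S j) sel" for a b
  proof -
    consider "a = j" "b = j" | "S a \<in> sel" "b = j" | "a = j" "S b \<in> sel" | "S a \<in> sel" "S b \<in> sel"
      using ab Sj by blast
    then show ?thesis
    proof cases
      case 1
      then show ?thesis
        using ij(2) Sj by (intro exI[of _ "[S j]"]) (auto simp: graph_path_def V dest!: Sj)
    next
      case 2
      then show ?thesis using new ab by blast
    next
      case 3
      then obtain p where p: "graph_path T (S b) p (S j)" "set p \<subseteq> insert (S j) sel"
        "\<And>k. k \<in> {1..d} \<Longrightarrow> S k \<in> set p \<Longrightarrow> ?S' b \<inter> ?S' j \<subseteq> ?S' k"
        using new[OF ab(2)] by blast
      have "?S' a \<inter> ?S' b \<subseteq> ?S' k" if "k \<in> {1..d}" "S k \<in> set (rev p)" for k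
        using p(3)[OF that(1)] that(2) unfolding \<open>a = j\<close> set_rev by blast
      moreover have "graph_path T (S a) (rev p) (S b)"
        using graph_path_rev[OF p(1)] \<open>a = j\<close> by simp
      moreover have "set (rev p) \<subseteq> insert (S j) sel"
        using p(2) by simp
      ultimately show ?thesis
        by blast
    next
      case 4
      then obtain p where p: "graph_path T (S a) p (S b)" "set p \<subseteq> sel"
        "\<And>k. k \<in> {1..d} \<Longrightarrow> S k \<in> set p \<Longrightarrow> S' a \<inter> S' b \<subseteq> S' k"
        using path[OF ab(1,2)] by blast
      \<comment> \<open>None of \<open>a\<close>, \<open>b\<close>, \<open>k\<close> equals
        \<open>j\<close>, since their sets are selected and \<open>S j\<close> is not; the update
        therefore changes none of the three sets.\<close>
      have "?S' a \<inter> ?S' b \<subseteq> ?S' k" if "k \<in> {1..d}" "S k \<in> set p" for k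
        using p(2) p(3)[OF that] that 4 neq[of a] neq[of b] neq[of k] by auto
      then show ?thesis
        using p(1,2) by blast
    qed
  qed
  have sep': "?S' a \<inter> S0 b = {}"
    if ab: "a \<in> {1..d}" "b \<in> {1..d}" "S a \<in> insert (S j) sel" "S b \<notin> insert (S j) sel" for a b
  proof (cases "a = j")
    case True
    \<comment> \<open>The two sources of \<open>R\<close> are treated separately:
      \<open>S' i\<close> by the old invariant, \<open>S0 j\<close> by disjointness of the initial
      copies.\<close>
    have "S' i \<inter> S0 b = {}"
      using sep ij ab by blast
    moreover have "S0 j \<inter> S0 b = {}"
      using ab ij by (intro disj) auto
    ultimately show ?thesis
      using R True by auto
  next
    case False
    then show ?thesis
      using sep[OF ab(1,2)] Sj ab by auto
  qed
  have sel': "insert (S j) sel \<subseteq> S ` {1..d}"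
    using sel ij by blast
  have bij': "bij_betw \<alpha> (?S' k) (S k)" if "k \<in> {1..d}" for k
    using bij[OF that] bij_R by simp
  have unsel': "?S' k = S0 k" if "k \<in> {1..d}" "S k \<notin> insert (S j) sel" for k
    using unsel that by auto
  show ?case
    unfolding R_def[symmetric]
    by (intro conjI ballI impI sel' bij' unsel' sep' path')
qed

section \<open>The projection formula\<close>

text \<open>A point of one face lifts by moving each weight to the unique preimage in
  \<open>A'\<close>. Conversely, sums over the fibres of \<alpha> preserve nonnegativity and total
  weight, and they vanish off \<open>A\<close> because \<alpha> sends \<open>A'\<close> into
  \<open>A\<close>.\<close>

lemma Qset_projection:
  assumes fin: "finite (\<Union>\<S>)" "finite (\<Union>\<S>')"
    and maps: "\<alpha> ` \<Union>\<S>' \<subseteq> \<Union>\<S>" and A: "A \<in> \<S>" and A': "A' \<in> \<S>'"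
    and bij: "bij_betw \<alpha> A' A"
  shows "Qset \<S> A = {x \<in> \<Union>\<S> \<rightarrow>\<^sub>E UNIV. \<exists>x'\<in>Qset \<S>' A'.
    \<forall>v\<in>\<Union>\<S>. x v = (\<Sum>u | u \<in> \<Union>\<S>' \<and> \<alpha> u = v. x' u)}" (is "_ = ?P")
proof
  show "Qset \<S> A \<subseteq> ?P"
  proof
    fix x assume x: "x \<in> Qset \<S> A"
    \<comment> \<open>Zero outside \<open>A'\<close> puts the lift on the right face; the
      restriction makes it \<open>undefined\<close> outside the index set, as membership in
      \<open>Qset\<close> demands.\<close>
    define x' where "x' = (\<lambda>u\<in>\<Union>\<S>'. if u \<in> A' then x (\<alpha> u) else 0)"
    have A'J: "A' \<subseteq> \<Union>\<S>'" "A \<subseteq> \<Union>\<S>"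
      using A A' by auto
    have im: "\<alpha> u \<in> A" if "u \<in> A'" for u
      using bij that by (auto simp: bij_betw_def)
    have "(\<Sum>u\<in>\<Union>\<S>'. x' u) = (\<Sum>u\<in>A'. x (\<alpha> u))"
      using A'J fin by (intro sum.mono_neutral_cong_right) (auto simp: x'_def)
    also have "\<dots> = (\<Sum>v\<in>A. x v)"
      by (rule sum.reindex_bij_betw[OF bij])
    also have "\<dots> = (\<Sum>v\<in>\<Union>\<S>. x v)"
      using A'J fin x by (intro sum.mono_neutral_left) (auto simp: Qset_def)
    finally have "(\<Sum>u\<in>\<Union>\<S>'. x' u) = 1"
      using x by (simp add: Qset_def)
    moreover have "0 \<le> x' u" if "u \<in> \<Union>\<S>'" for u
      using x im[of u] A'J that by (auto simp: Qset_def x'_def)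
    ultimately have "x' \<in> Qset \<S>' A'"
      unfolding Qset_def mem_Collect_eq
      by (intro conjI ballI) (assumption | simp add: x'_def del: Union_iff)+
    moreover have "x v = (\<Sum>u | u \<in> \<Union>\<S>' \<and> \<alpha> u = v. x' u)" if v: "v \<in> \<Union>\<S>" for v
    proof -
      \<comment> \<open>A fibre may also contain indices from other sets of the new collection, but
        the lift is zero there.\<close>
      have "(\<Sum>u | u \<in> \<Union>\<S>' \<and> \<alpha> u = v. x' u) = (\<Sum>u | u \<in> A' \<and> \<alpha> u = v. x v)"
        using A'J fin by (intro sum.mono_neutral_cong_right finite_subset[OF _ fin(2)])
          (auto simp: x'_def)
      also have "\<dots> = x v"
      proof (cases "v \<in> A")
        case True
        then obtain w where w: "w \<in> A'" "\<alpha> w = v"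
          using bij by (auto simp: bij_betw_def)
        then have "{u. u \<in> A' \<and> \<alpha> u = v} = {w}"
          using bij by (auto simp: bij_betw_def dest: inj_onD)
        then show ?thesis by simp
      next
        case False
        then have "x v = 0" using x v by (auto simp: Qset_def)
        then show ?thesis by simp
      qed
      finally show ?thesis ..
    qed
    ultimately show "x \<in> ?P"
      using x by (auto simp: Qset_def)
  qed
next
  show "?P \<subseteq> Qset \<S> A"
  proof
    fix x assume "x \<in> ?P"
    then obtain x' where x: "x \<in> \<Union>\<S> \<rightarrow>\<^sub>E UNIV" and x': "x' \<in> Qset \<S>' A'"
      and eq: "\<And>v. v \<in> \<Union>\<S> \<Longrightarrow> x v = (\<Sum>u | u \<in> \<Union>\<S>' \<and> \<alpha> u = v. x' u)"
      by blast
    have "(\<Sum>v\<in>\<Union>\<S>. x v) = (\<Sum>v\<in>\<Union>\<S>. \<Sum>u | u \<in> \<Union>\<S>' \<and> \<alpha> u = v. x' u)"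
      using eq by (rule sum.cong[OF refl])
    \<comment> \<open>The fibres of \<alpha> over the old ground set partition the new one.\<close>
    also have "\<dots> = (\<Sum>u\<in>\<Union>\<S>'. x' u)"
      using fin maps by (intro sum.group)
    finally have "(\<Sum>v\<in>\<Union>\<S>. x v) = 1"
      using x' by (simp add: Qset_def)
    moreover have "x v = 0" if "v \<in> \<Union>\<S> - A" for v
    proof -
      have "x' u = 0" if "u \<in> \<Union>\<S>'" "\<alpha> u = v" for u
        using x' bij that \<open>v \<in> \<Union>\<S> - A\<close> unfolding Qset_def bij_betw_def by blast
      then show ?thesis
        using eq that by (auto intro!: sum.neutral)
    qed
    moreover have "0 \<le> x v" if "v \<in> \<Union>\<S>" for v
      unfolding eq[OF that] using x' by (intro sum_nonneg) (auto simp: Qset_def)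
    ultimately show "x \<in> Qset \<S> A"
      using x unfolding Qset_def by blast
  qed
qed

text \<open>Projection commutes with unions, so the formula for single faces can be applied to each
  \<open>i\<close> separately.\<close>

lemma CDC_projection:
  fixes S :: "'i \<Rightarrow> 'v set" and S' :: "'i \<Rightarrow> 'u set"
  assumes I: "finite I" and fin: "\<And>i. i \<in> I \<Longrightarrow> finite (S i)"
    and bij: "\<And>i. i \<in> I \<Longrightarrow> bij_betw \<alpha> (S' i) (S i)"
  shows "CDC (S ` I) = fst ` {(x, x'). x \<in> (\<Union>i\<in>I. S i) \<rightarrow>\<^sub>E (UNIV :: real set) \<and>
    (\<forall>v\<in>(\<Union>i\<in>I. S i). x v = (\<Sum>u | u \<in> \<Union>(S' ` I) \<and> \<alpha> u = v. x' u)) \<and>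
    x' \<in> CDC (S' ` I)}"
proof -
  have fin': "finite (S' i)" if "i \<in> I" for i
    using bij_betw_finite[OF bij[OF that]] fin[OF that] by simp
  have maps: "\<alpha> ` \<Union>(S' ` I) \<subseteq> \<Union>(S ` I)"
    using bij unfolding bij_betw_def by blast
  have Q: "Qset (S ` I) (S i) = {x \<in> \<Union>(S ` I) \<rightarrow>\<^sub>E UNIV. \<exists>x'\<in>Qset (S' ` I) (S' i).
      \<forall>v\<in>\<Union>(S ` I). x v = (\<Sum>u | u \<in> \<Union>(S' ` I) \<and> \<alpha> u = v. x' u)}" if "i \<in> I" for i
  proof (rule Qset_projection[OF _ _ maps])
    show "finite (\<Union>(S ` I))" "finite (\<Union>(S' ` I))"
      using I fin fin' by blast+
  qed (use that bij in simp_all)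
  show ?thesis (is "_ = ?R")
  proof (rule set_eqI)
    fix x :: "'v \<Rightarrow> real"
    have CDC': "x' \<in> CDC (S' ` I) \<longleftrightarrow> (\<exists>i\<in>I. x' \<in> Qset (S' ` I) (S' i))" for x'
      by (simp add: CDC_def)
    have swap: "(\<exists>i\<in>I. P \<and> (\<exists>x'\<in>Q i. R x')) \<longleftrightarrow> (\<exists>x'. P \<and> R x' \<and> (\<exists>i\<in>I. x' \<in> Q i))"
      for P and Q :: "'i \<Rightarrow> ('u \<Rightarrow> real) set" and R
      by blast
    have fst_image: "x \<in> fst ` {(x, x'). P x \<and> Q x x' \<and> R x'} \<longleftrightarrow>
        (\<exists>x'. P x \<and> Q x x' \<and> R x')"
      for P Q and R :: "('u \<Rightarrow> real) \<Rightarrow> bool"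
      by force
    have "x \<in> CDC (S ` I) \<longleftrightarrow> (\<exists>i\<in>I. x \<in> Qset (S ` I) (S i))"
      by (simp add: CDC_def)
    also have "\<dots> \<longleftrightarrow> (\<exists>i\<in>I. x \<in> \<Union>(S ` I) \<rightarrow>\<^sub>E UNIV \<and> (\<exists>x'\<in>Qset (S' ` I) (S' i).
        \<forall>v\<in>\<Union>(S ` I). x v = (\<Sum>u | u \<in> \<Union>(S' ` I) \<and> \<alpha> u = v. x' u)))"
      by (rule bex_cong[OF refl]) (simp only: Q mem_Collect_eq)
    also have "\<dots> \<longleftrightarrow> (\<exists>x'. x \<in> \<Union>(S ` I) \<rightarrow>\<^sub>E UNIV \<and>
        (\<forall>v\<in>\<Union>(S ` I). x v = (\<Sum>u | u \<in> \<Union>(S' ` I) \<and> \<alpha> u = v. x' u)) \<and> x' \<in> CDC (S' ` I))"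
      unfolding CDC' by (rule swap)
    also have "\<dots> \<longleftrightarrow> x \<in> ?R"
      by (rule fst_image[symmetric])
    finally show "x \<in> CDC (S ` I) \<longleftrightarrow> x \<in> ?R" .
  qed
qed

text \<open>\<open>S i\<close> is recovered from \<open>S' i\<close> as its image under
  \<alpha>.\<close>

lemma inj_on_of_bij_betw_images:
  assumes "inj_on S I" "\<And>i. i \<in> I \<Longrightarrow> bij_betw \<alpha> (S' i) (S i)"
  shows "inj_on S' I"
  using assms unfolding inj_on_def bij_betw_def by metis

section \<open>Correctness of the reformulation\<close>

text \<open>Distinct sets of the collection have empty intersection, so any path between them will
  do; for equal endpoints the one-vertex path is taken.\<close>

lemma junction_tree_disjoint:
  fixes d :: nat
  assumes d: "d \<ge> 1" and inj: "inj_on S' {1..d}" and disj: "disjoint_family_on S' {1..d}"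
  shows "junction_tree (S' ` {1..d})
    \<lparr>vertices = S' ` {1..d}, edges = {{S' i, S' (i + 1)} | i. 1 \<le> i \<and> i < d}\<rparr>"
proof -
  have "map_ugraph S' (line_graph d) =
    \<lparr>vertices = S' ` {1..d}, edges = {{S' i, S' (i + 1)} | i. 1 \<le> i \<and> i < d}\<rparr>" (is "_ = ?T'")
    by (auto simp: map_ugraph_def line_graph_def image_iff) (metis image_empty image_insert)
  then have tree: "tree_graph ?T'"
    using tree_graph_map[OF tree_graph_line[OF d], of S'] inj by (simp add: line_graph_def)
  show ?thesis
  proof (rule junction_treeI[OF tree])
    fix A B assume AB: "A \<in> S' ` {1..d}" "B \<in> S' ` {1..d}"
    show "\<exists>p. graph_path ?T' A p B \<and> (\<forall>C\<in>set p. A \<inter> B \<subseteq> C)"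
    proof (cases "A = B")
      case True
      then show ?thesis
        using AB by (intro exI[of _ "[A]"]) (auto simp: graph_path_def)
    next
      case False
      obtain a b where ab: "a \<in> {1..d}" "b \<in> {1..d}" "A = S' a" "B = S' b"
        using AB by blast
      then have "a \<noteq> b"
        using False by blast
      then have disj_AB: "A \<inter> B = {}"
        using disjoint_family_onD[OF disj] ab by simp
      have "A \<in> vertices ?T'" "B \<in> vertices ?T'"
        using AB by simp_all
      then obtain p where "graph_path ?T' A p B"
        using tree unfolding tree_graph_def by meson
      then show ?thesis
        unfolding disj_AB by blast
    qed
  qed simp
qed

text \<open>The loop invariant speaks of paths in \<open>T\<close>, whose vertices are the original
  sets; relabelling transfers these paths to the output tree.\<close>

lemma junction_tree_merged:
  assumes inj: "inj_on S I" "inj_on S' I"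
    and tree: "tree_graph T" and V: "vertices T = S ` I"
    and ex: "\<And>a b. a \<in> I \<Longrightarrow> b \<in> I \<Longrightarrow> \<exists>p. graph_path T (S a) p (S b) \<and>
      (\<forall>k\<in>I. S k \<in> set p \<longrightarrow> S' a \<inter> S' b \<subseteq> S' k)"
  shows "junction_tree (S' ` I) \<lparr>vertices = S' ` I,
    edges = {{S' i, S' j} | i j. i \<in> I \<and> j \<in> I \<and> {S i, S j} \<in> edges T}\<rparr>"
    (is "junction_tree _ ?T'")
proof -
  \<comment> \<open>The relabelling of \<open>S i\<close> as \<open>S' i\<close>, well defined
    because \<open>S\<close> is injective on \<open>I\<close>.\<close>
  define f where "f = S' \<circ> inv_into I S"
  have f: "f (S i) = S' i" if "i \<in> I" for i
    using that inj by (simp add: f_def)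
  have inj_f: "inj_on f (vertices T)"
    unfolding f_def V using inj by (intro comp_inj_on inj_on_inv_into) (auto simp: inj_on_def)
  have "edges (map_ugraph f T) \<subseteq> edges ?T'"
  proof
    fix e assume "e \<in> edges (map_ugraph f T)"
    then obtain e' where e': "e' \<in> edges T" "e = f ` e'"
      by (auto simp: map_ugraph_def)
    then obtain i j where "i \<in> I" "j \<in> I" "e' = {S i, S j}"
      using tree unfolding tree_graph_def simple_graph_def complete_edges_def V by blast
    then show "e \<in> edges ?T'"
      using e' f by auto
  qed
  moreover have "edges ?T' \<subseteq> edges (map_ugraph f T)"
  proof
    fix e assume "e \<in> edges ?T'"
    then obtain i j where ij: "i \<in> I" "j \<in> I" "{S i, S j} \<in> edges T" "e = {S' i, S' j}"
      by auto
    then have e: "e = f ` {S i, S j}" using f by auto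
    show "e \<in> edges (map_ugraph f T)"
      unfolding e
      using imageI[OF ij(3), of "(`) f"] by (simp add: map_ugraph_def)
  qed
  moreover have VT': "vertices (map_ugraph f T) = S' ` I"
    using f by (auto simp: map_ugraph_def V image_image)
  ultimately have T': "?T' = map_ugraph f T"
    by (simp add: ugraph.equality)
  show ?thesis
    unfolding T'
  proof (rule junction_treeI[OF tree_graph_map[OF tree inj_f] VT'])
    fix A B assume "A \<in> S' ` I" "B \<in> S' ` I"
    then obtain a b where ab: "a \<in> I" "b \<in> I" "A = S' a" "B = S' b"
      by blast
    obtain p where p: "graph_path T (S a) p (S b)"
      "\<forall>k\<in>I. S k \<in> set p \<longrightarrow> S' a \<inter> S' b \<subseteq> S' k"
      using ex ab by blast
    have "set p \<subseteq> S ` I"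
      using p(1) by (simp add: graph_path_def V)
    have "A \<inter> B \<subseteq> C" if C: "C \<in> set (map f p)" for C
    proof -
      obtain X where X: "X \<in> set p" "C = f X"
        using C by auto
      then obtain k where "k \<in> I" "X = S k"
        using \<open>set p \<subseteq> S ` I\<close> by blast
      then show ?thesis
        using p(2) X f ab(3,4) by simp
    qed
    moreover have "graph_path (map_ugraph f T) A (map f p) B"
      using graph_path_map[OF inj_f p(1)] by (simp add: f ab)
    ultimately show "\<exists>p. graph_path (map_ugraph f T) A p B \<and> (\<forall>C\<in>set p. A \<inter> B \<subseteq> C)"
      by blast
  qed
qed

theorem proposition17:
  fixes S :: "nat \<Rightarrow> 'v set" and d :: nat and disj :: bool
    and \<S>' :: "'v set set" and \<alpha> :: "'v \<Rightarrow> 'v" and T' :: "'v set ugraph"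
  assumes "d \<ge> 1"
    and "inj_on S {1..d}"
    and "\<forall>i\<in>{1..d}. finite (S i)"
    and "reformulation S d disj \<S>' \<alpha> T'"
  shows "junction_tree \<S>' T' \<and>
    CDC (S ` {1..d}) =
      fst ` {(x, x'). x \<in> (\<Union>i\<in>{1..d}. S i) \<rightarrow>\<^sub>E (UNIV :: real set) \<and>
        (\<forall>v\<in>(\<Union>i\<in>{1..d}. S i). x v = (\<Sum>u | u \<in> \<Union>\<S>' \<and> \<alpha> u = v. x' u)) \<and>
        x' \<in> CDC \<S>'}"
  using assms(4)
proof cases
  case (disjoint_True S')
  have bij: "bij_betw \<alpha> (S' i) (S i)" if "i \<in> {1..d}" for i
    using disjoint_True that by (simp add: fresh_copies_def)
  have "disjoint_family_on S' {1..d}"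
    using disjoint_True by (simp add: fresh_copies_def)
  then have "junction_tree \<S>' T'"
    unfolding disjoint_True
    using assms(1) inj_on_of_bij_betw_images[OF assms(2) bij] by (intro junction_tree_disjoint)
  then show ?thesis
    unfolding disjoint_True(2) using assms(3) bij by (intro conjI CDC_projection) auto
next
  case (disjoint_False S0 \<beta> T sel S')
  have T: "tree_graph T" "vertices T = S ` {1..d}"
    using disjoint_False
    by (auto simp: maximum_spanning_tree_def spanning_tree_def intersection_graph_def)
  note inv = merge_loop_invariant[OF disjoint_False(7) assms(1,2) disjoint_False(5) T(2)]
  \<comment> \<open>On exit \<open>sel\<close> has at least \<open>d\<close> elements and lies in a
    set of exactly \<open>d\<close> elements, so the invariant covers all vertices.\<close>
  have sel: "sel = S ` {1..d}"
  proof (rule card_seteq)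
    show "sel \<subseteq> S ` {1..d}" using inv by blast
    show "card (S ` {1..d}) \<le> card sel"
      using disjoint_False(8) assms(2) by (simp add: card_image)
  qed simp
  have "bij_betw \<beta> (S' i) (S i)" if "i \<in> {1..d}" for i
    using inv that by blast
  \<comment> \<open>The returned \<alpha> is the restriction of \<open>\<beta>\<close> to the union
    of the final sets, and so agrees with it on every \<open>S' i\<close>.\<close>
  then have bij: "bij_betw \<alpha> (S' i) (S i)" if "i \<in> {1..d}" for i
    unfolding disjoint_False using that by (subst bij_betw_cong[where g = \<beta>]) auto
  have "junction_tree \<S>' T'"
    unfolding disjoint_False(2,4)
    using assms(2) inj_on_of_bij_betw_images[OF assms(2) bij] T
  proof (rule junction_tree_merged)
    show "\<exists>p. graph_path T (S a) p (S b) \<and>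
        (\<forall>k\<in>{1..d}. S k \<in> set p \<longrightarrow> S' a \<inter> S' b \<subseteq> S' k)"
      if "a \<in> {1..d}" "b \<in> {1..d}" for a b
      using inv[THEN conjunct2, THEN conjunct2, THEN conjunct2, THEN conjunct2, rule_format,
          unfolded sel, OF that imageI[OF that(1)] imageI[OF that(2)]]
      by (elim ex_forward) simp
  qed
  then show ?thesis
    unfolding disjoint_False(2) using assms(3) bij by (intro conjI CDC_projection) auto
qed

end
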